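(* Let $p$ be a non-constant SONC polynomial in $n$ variables that is $\mathcal{S}_n$-invariant. For $\omega\in\{\pm1\}^n$: (1) If $p^\omega\neq\tilde p$, then $V_{>0}(p^\omega)$ is empty. (2) If $p^\omega=\tilde p$, then $V_{>0}(p^\omega)=V_{>0}(\tilde p)$, and this set, if non-empty, is one of the following: (a) a singleton on the diagonal in $\mathbb{R}_{>0}^n$, (b) the diagonal in $\mathbb{R}_{>0}^n$, (c) a hypersurface of the form $\{x:\prod_{i=1}^n x_i=\tau\}$ intersected with $\mathbb{R}_{>0}^n$, for some constant $\tau>0$.
   Context: $\mathcal{S}_n$ acts on polynomials by permuting variables; the diagonal in $\mathbb{R}_{>0}^n$ is $\{(t,\ldots,t):t>0\}$. $V_{>0}(q)=\{x\in\mathbb{R}_{>0}^n:q(x)=0\}$. For a polynomial $p=\sum_{\alpha\in\mathcal{A}}c_\alpha x^\alpha$ with $\mathcal{A}\subset\mathbb{N}^n$ finite ($0\in\mathbb{N}$) and $\omega\in\{\pm1\}^n$, $p^\omega(x)=p(\omega_1x_1,\ldots,\omega_nx_n)$ and $\tilde p(x)=\sum_{\alpha\in\mathcal{A}\cap(2\mathbb{N})^n}c_\alpha x^\alpha-\sum_{\gamma\in\mathcal{A}\setminus(2\mathbb{N})^n}|c_\gamma|x^\gamma$. For a finite set $\mathcal{A}\subset\mathbb{N}^n$ and $\beta\in\mathbb{N}^n\setminus\mathcal{A}$, $C_{\mathrm{AG}}(\mathcal{A},\beta)$ is the set of polynomials $\sum_{\alpha\in\mathcal{A}}c_\alpha x^\alpha+c_\beta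 x^\beta$ with $c_\alpha\ge0$ for $\alpha\in\mathcal{A}$, $c_\beta\in\mathbb{R}$, $c_\gamma=0$ for all $\gamma\in\mathcal{A}\setminus(2\mathbb{N})^n$, that are nonnegative on $\mathbb{R}^n$. A SONC polynomial is an element of $C_{\mathrm{SONC}}(\mathcal{T})=\sum_{\beta\in\mathcal{T}}C_{\mathrm{AG}}(\mathcal{T}\setminus\{\beta\},\beta)$ for some nonempty finite $\mathcal{T}\subset\mathbb{N}^n$. *)

theory Defs
  imports "HOL-Analysis.Analysis" "HOL-Library.Poly_Mapping"
begin

text \<open>
  The type variable \<open>'n\<close> indexes the variables, so \<open>n\<close> is \<open>CARD('n)\<close>. A polynomial is its
  finitely supported coefficient function on the exponent vectors.
\<close>

type_synonym 'n rpoly = "(nat ^ 'n) \<Rightarrow>\<^sub>0 real"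

definition peval :: "('n::finite) rpoly \<Rightarrow> real ^ 'n \<Rightarrow> real" where
  "peval p x = (\<Sum>\<alpha>\<in>Poly_Mapping.keys p. Poly_Mapping.lookup p \<alpha> * (\<Prod>i\<in>UNIV. (x $ i) ^ (\<alpha> $ i)))"

definition constant_poly :: "('n::finite) rpoly \<Rightarrow> bool" where
  "constant_poly p \<longleftrightarrow> (\<exists>c. p = Poly_Mapping.single 0 c)"

text \<open>
  The polynomial \<open>p (x\<^bsub>\<sigma> 1\<^esub>, \<dots>, x\<^bsub>\<sigma> n\<^esub>)\<close>: the monomial with exponent \<open>\<alpha>\<close> becomes the one
  with exponent \<open>\<alpha> \<circ> inv \<sigma>\<close>, so the new coefficient at \<open>\<beta>\<close> is the old one at \<open>\<beta> \<circ> \<sigma>\<close>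
  (see \<open>peval_permute_vars\<close> below).
\<close>

definition permute_vars :: "('n \<Rightarrow> 'n) \<Rightarrow> ('n::finite) rpoly \<Rightarrow> 'n rpoly" where
  "permute_vars \<sigma> p = Poly_Mapping.map_key (\<lambda>\<beta>. \<chi> i. \<beta> $ \<sigma> i) p"

definition symmetric_poly :: "('n::finite) rpoly \<Rightarrow> bool" where
  "symmetric_poly p \<longleftrightarrow> (\<forall>\<sigma>. \<sigma> permutes UNIV \<longrightarrow> permute_vars \<sigma> p = p)"

text \<open>\<open>p (\<omega>\<^sub>1 x\<^sub>1, \<dots>, \<omega>\<^sub>n x\<^sub>n)\<close> as a polynomial (see \<open>peval_scale_vars\<close> below).\<close>

definition scale_vars :: "real ^ 'n \<Rightarrow> ('n::finite) rpoly \<Rightarrow> 'n rpoly" where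
  "scale_vars \<omega> p = Poly_Mapping.mapp (\<lambda>\<alpha> c. c * (\<Prod>i\<in>UNIV. (\<omega> $ i) ^ (\<alpha> $ i))) p"

definition even_vec :: "nat ^ ('n::finite) \<Rightarrow> bool" where
  "even_vec \<alpha> \<longleftrightarrow> (\<forall>i. even (\<alpha> $ i))"

definition tilde :: "('n::finite) rpoly \<Rightarrow> 'n rpoly" where
  "tilde p = Poly_Mapping.mapp (\<lambda>\<alpha> c. if even_vec \<alpha> then c else - \<bar>c\<bar>) p"

definition pos_orthant :: "(real ^ 'n::finite) set" where
  "pos_orthant = {x. \<forall>i. x $ i > 0}"

definition pos_diagonal :: "(real ^ 'n::finite) set" where
  "pos_diagonal = {(\<chi> i. t) |t. t > 0}"

definition V_pos :: "('n::finite) rpoly \<Rightarrow> (real ^ 'n) set" where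
  "V_pos q = {x \<in> pos_orthant. peval q x = 0}"

text \<open>Meant for finite \<open>A\<close> and \<open>\<beta> \<notin> A\<close>; otherwise the coefficient at \<open>\<beta>\<close> would be constrained too.\<close>

definition AG_cone :: "(nat ^ 'n) set \<Rightarrow> nat ^ 'n \<Rightarrow> ('n::finite) rpoly set" where
  "AG_cone A \<beta> = {f. Poly_Mapping.keys f \<subseteq> insert \<beta> A
      \<and> (\<forall>\<alpha>\<in>A. Poly_Mapping.lookup f \<alpha> \<ge> 0)
      \<and> (\<forall>\<gamma>\<in>A. \<not> even_vec \<gamma> \<longrightarrow> Poly_Mapping.lookup f \<gamma> = 0)
      \<and> (\<forall>x. peval f x \<ge> 0)}"

text \<open>The sum is the Minkowski sum of sets from \<open>Set_Algebras\<close>.\<close>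

definition SONC_cone :: "(nat ^ 'n) set \<Rightarrow> ('n::finite) rpoly set" where
  "SONC_cone T = (\<Sum>\<beta>\<in>T. AG_cone (T - {\<beta>}) \<beta>)"

definition SONC_poly :: "('n::finite) rpoly \<Rightarrow> bool" where
  "SONC_poly p \<longleftrightarrow> (\<exists>T. finite T \<and> T \<noteq> {} \<and> p \<in> SONC_cone T)"

lemma peval_superset:
  assumes "finite S" "Poly_Mapping.keys p \<subseteq> S"
  shows "peval p x = (\<Sum>\<alpha>\<in>S. Poly_Mapping.lookup p \<alpha> * (\<Prod>i\<in>UNIV. (x $ i) ^ (\<alpha> $ i)))"
  unfolding peval_def by (rule sum.mono_neutral_left) (use assms in \<open>auto simp: in_keys_iff\<close>)

lemma lookup_permute_vars:
  assumes "\<sigma> permutes (UNIV :: 'n::finite set)"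
  shows "Poly_Mapping.lookup (permute_vars \<sigma> p) \<beta> = Poly_Mapping.lookup p (\<chi> i. \<beta> $ \<sigma> i)"
proof -
  have "inj (\<lambda>\<beta> :: nat ^ 'n. \<chi> i. \<beta> $ \<sigma> i)"
    by (rule injI) (metis (mono_tags, lifting) assms permutes_univ vec_eq_iff vec_lambda_beta)
  then show ?thesis
    by (simp add: permute_vars_def map_key.rep_eq)
qed

lemma peval_permute_vars:
  assumes s: "\<sigma> permutes (UNIV :: 'n::finite set)"
  shows "peval (permute_vars \<sigma> p) x = peval p (\<chi> i. x $ \<sigma> i)"
proof -
  let ?g = "\<lambda>\<beta> :: nat ^ 'n. \<chi> i. \<beta> $ \<sigma> i"
  let ?h = "\<lambda>\<alpha> :: nat ^ 'n. \<chi> i. \<alpha> $ inv \<sigma> i"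
  have gh: "?g (?h \<alpha>) = \<alpha>" "?h (?g \<alpha>) = \<alpha>" for \<alpha>
    using permutes_inverses[OF s] by (simp_all add: vec_eq_iff)
  have "(\<Prod>i\<in>UNIV. (x $ i) ^ (\<beta> $ i)) = (\<Prod>i\<in>UNIV. (x $ \<sigma> i) ^ (\<beta> $ \<sigma> i))" for \<beta> :: "nat ^ 'n"
    using prod.permute[OF s, of "\<lambda>i. (x $ i) ^ (\<beta> $ i)"] by (simp add: o_def)
  then show ?thesis
    unfolding peval_def
    by (intro sum.reindex_bij_witness[where i = ?h and j = ?g])
      (simp_all only: gh in_keys_iff lookup_permute_vars[OF s], simp_all)
qed

lemma peval_scale_vars: "peval (scale_vars \<omega> p) x = peval p (\<chi> i. \<omega> $ i * x $ i)"
proof -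
  have "Poly_Mapping.keys (scale_vars \<omega> p) \<subseteq> Poly_Mapping.keys p"
    by (auto simp: scale_vars_def in_keys_iff mapp.rep_eq when_def split: if_splits)
  from peval_superset[OF finite_keys this] show ?thesis
    by (simp add: peval_def scale_vars_def mapp.rep_eq power_mult_distrib prod.distrib mult_ac)
qed

end

theory Submission
  imports Defs
begin

text \<open>
  On the positive orthant all monomials are positive, and coefficientwise
  \<open>scale_vars \<omega> p \<ge> tilde p\<close>. If the two polynomials differ, then \<open>scale_vars \<omega> p\<close> is strictly
  larger than \<open>tilde p\<close> there (\<open>peval_tilde_less_scale_vars\<close>). On the other hand \<open>tilde p\<close> is a sum
  of globally nonnegative polynomials, each with at most one negative coefficient: every AG summand
  \<open>f\<close> of \<open>p\<close> satisfies \<open>tilde f = scale_vars \<epsilon> f\<close> for a suitable sign vector \<open>\<epsilon>\<close>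
  (\<open>SONC_tilde_decomposition\<close>). Hence \<open>scale_vars \<omega> p\<close> has no positive zero unless it equals
  \<open>tilde p\<close>.

  For the shape of the zero set of \<open>tilde p\<close>, write the positive orthant as the image of the
  coordinatewise exponential map. A summand with distinguished exponent \<open>\<beta>\<close> becomes
  the product of \<open>exp (\<beta> \<bullet> y)\<close> and a convex factor: a constant plus a nonnegative combination of
  exponentials of linear forms. If this factor is nonnegative and vanishes at two points, it is
  constant along the line through them, because all its linear forms are
  (\<open>AG_log_zeros_exponents\<close>). So the
  logarithmic zero set of \<open>tilde p\<close>, an intersection of the logarithmic zero sets of the summands,
  is an affine subspace, and it is proper because \<open>p \<noteq> 0\<close> (\<open>SONC_tilde_nonneg_affine_zeros\<close>). It is also
  invariant under permuting coordinates. The only nonempty proper affine subspaces with this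
  invariance are the diagonal points, the diagonal, and the hyperplanes on which the coordinate sum
  is constant (\<open>swap_invariant_affine_cases\<close>); exponentiating gives the three alternatives.
\<close>

section \<open>Sign changes and SONC decompositions\<close>

lemma lookup_tilde:
  "Poly_Mapping.lookup (tilde p) \<alpha> =
    (if even_vec \<alpha> then Poly_Mapping.lookup p \<alpha> else - \<bar>Poly_Mapping.lookup p \<alpha>\<bar>)"
  by (simp add: tilde_def mapp.rep_eq when_def in_keys_iff)

lemma lookup_scale_vars:
  "Poly_Mapping.lookup (scale_vars \<omega> p) \<alpha> =
    Poly_Mapping.lookup p \<alpha> * (\<Prod>i\<in>UNIV. (\<omega> $ i) ^ (\<alpha> $ i))"
  by (simp add: scale_vars_def mapp.rep_eq when_def in_keys_iff)

lemma keys_tilde: "Poly_Mapping.keys (tilde p) = Poly_Mapping.keys p"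
  by (auto simp: in_keys_iff lookup_tilde split: if_splits)

lemma peval_sum:
  assumes "finite T" "\<And>\<beta>. \<beta> \<in> I \<Longrightarrow> Poly_Mapping.keys (g \<beta>) \<subseteq> T"
  shows "peval (\<Sum>\<beta>\<in>I. g \<beta>) x = (\<Sum>\<beta>\<in>I. peval (g \<beta>) x)"
proof -
  have "Poly_Mapping.keys (\<Sum>\<beta>\<in>I. g \<beta>) \<subseteq> T"
    using keys_sum[of g I] assms(2) by blast
  then have "peval (\<Sum>\<beta>\<in>I. g \<beta>) x =
      (\<Sum>\<alpha>\<in>T. \<Sum>\<beta>\<in>I. Poly_Mapping.lookup (g \<beta>) \<alpha> * (\<Prod>i\<in>UNIV. (x $ i) ^ (\<alpha> $ i)))"
    by (simp add: peval_superset[OF assms(1)] lookup_sum sum_distrib_right)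
  also have "\<dots> = (\<Sum>\<beta>\<in>I. peval (g \<beta>) x)"
    by (subst sum.swap) (simp add: peval_superset[OF assms(1) assms(2)])
  finally show ?thesis .
qed

lemma sign_vector_monomial:
  fixes \<omega> :: "real ^ 'n::finite"
  assumes "\<forall>i. \<omega> $ i \<in> {1, -1}"
  shows "\<bar>\<Prod>i\<in>UNIV. (\<omega> $ i) ^ (\<alpha> $ i)\<bar> = 1"
    and "even_vec \<alpha> \<Longrightarrow> (\<Prod>i\<in>UNIV. (\<omega> $ i) ^ (\<alpha> $ i)) = 1"
proof -
  have "\<bar>\<omega> $ i\<bar> = 1" for i
    using assms by (metis abs_1 abs_minus_cancel insertE singletonD)
  then show "\<bar>\<Prod>i\<in>UNIV. (\<omega> $ i) ^ (\<alpha> $ i)\<bar> = 1"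
    by (simp add: abs_prod power_abs)
next
  assume "even_vec \<alpha>"
  have "(\<omega> $ i) ^ (\<alpha> $ i) = 1" for i
  proof -
    have "\<omega> $ i = 1 \<or> \<omega> $ i = - 1"
      using assms by blast
    then show ?thesis
      using \<open>even_vec \<alpha>\<close> by (auto simp: even_vec_def)
  qed
  then show "(\<Prod>i\<in>UNIV. (\<omega> $ i) ^ (\<alpha> $ i)) = 1"
    by simp
qed

text \<open>
  A sign change fixes even coefficients and keeps the modulus of odd ones, while \<open>tilde\<close> picks the
  smaller of the two possible signs.
\<close>

lemma lookup_tilde_le_scale_vars:
  fixes \<omega> :: "real ^ 'n::finite"
  assumes "\<forall>i. \<omega> $ i \<in> {1, -1}"
  shows "Poly_Mapping.lookup (tilde p) \<alpha> \<le> Poly_Mapping.lookup (scale_vars \<omega> p) \<alpha>"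
proof (cases "even_vec \<alpha>")
  case True
  then show ?thesis
    by (simp add: lookup_tilde lookup_scale_vars sign_vector_monomial[OF assms])
next
  case False
  have "\<bar>Poly_Mapping.lookup (scale_vars \<omega> p) \<alpha>\<bar> = \<bar>Poly_Mapping.lookup p \<alpha>\<bar>"
    by (simp add: lookup_scale_vars abs_mult sign_vector_monomial[OF assms])
  then show ?thesis
    using False by (simp add: lookup_tilde)
qed

lemma peval_tilde_less_scale_vars:
  fixes \<omega> :: "real ^ 'n::finite"
  assumes "\<forall>i. \<omega> $ i \<in> {1, -1}" "scale_vars \<omega> p \<noteq> tilde p" "x \<in> pos_orthant"
  shows "peval (tilde p) x < peval (scale_vars \<omega> p) x"
proof -
  have sub: "Poly_Mapping.keys (scale_vars \<omega> p) \<subseteq> Poly_Mapping.keys p"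
    by (auto simp: in_keys_iff lookup_scale_vars)
  have pos: "(\<Prod>i\<in>UNIV. (x $ i) ^ (\<alpha> $ i)) > 0" for \<alpha>
    using assms(3) by (intro prod_pos) (auto simp: pos_orthant_def)
  obtain \<gamma> where \<gamma>: "Poly_Mapping.lookup (scale_vars \<omega> p) \<gamma> \<noteq> Poly_Mapping.lookup (tilde p) \<gamma>"
    using assms(2) by (meson poly_mapping_eqI)
  then have "\<gamma> \<in> Poly_Mapping.keys p"
    by (auto simp: in_keys_iff lookup_scale_vars lookup_tilde split: if_splits)
  moreover have "Poly_Mapping.lookup (tilde p) \<gamma> < Poly_Mapping.lookup (scale_vars \<omega> p) \<gamma>"
    using \<gamma> lookup_tilde_le_scale_vars[OF assms(1), of p \<gamma>] by simp
  ultimately show ?thesis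
    unfolding peval_superset[OF finite_keys sub] peval_superset[OF finite_keys equalityD1[OF keys_tilde]]
    using lookup_tilde_le_scale_vars[OF assms(1)] pos
    by (intro sum_strict_mono_ex1) (auto intro!: bexI[of _ \<gamma>] mult_right_mono mult_strict_right_mono less_imp_le)
qed

text \<open>
  At most one odd exponent of an AG polynomial carries a nonzero coefficient. If this coefficient
  is positive, flipping one variable that occurs to an odd power in its monomial turns \<open>f\<close> into
  \<open>tilde f\<close>; otherwise the two agree. It follows that \<open>tilde f\<close> is again nonnegative everywhere.
\<close>

lemma AG_tilde_eq_scale_vars:
  fixes f :: "('n::finite) rpoly"
  assumes "f \<in> AG_cone A \<beta>"
  obtains \<omega> where "tilde f = scale_vars \<omega> f"
proof (cases "even_vec \<beta> \<or> Poly_Mapping.lookup f \<beta> \<le> 0")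
  case True
  have "Poly_Mapping.lookup (tilde f) \<alpha> = Poly_Mapping.lookup (scale_vars (\<chi> i. 1) f) \<alpha>" for \<alpha>
  proof (cases "\<alpha> \<in> insert \<beta> A")
    case False
    then have "Poly_Mapping.lookup f \<alpha> = 0"
      using assms by (auto simp: AG_cone_def in_keys_iff)
    then show ?thesis
      by (simp add: lookup_tilde lookup_scale_vars)
  qed (use True assms in \<open>auto simp: AG_cone_def lookup_tilde lookup_scale_vars\<close>)
  then show ?thesis
    using that poly_mapping_eqI by blast
next
  case False
  then obtain k where k: "odd (\<beta> $ k)"
    by (auto simp: even_vec_def)
  let ?\<omega> = "\<chi> i. if i = k then - 1 else 1"
  have sgn: "(\<Prod>i\<in>UNIV. (?\<omega> $ i) ^ (\<alpha> $ i)) = (- 1) ^ (\<alpha> $ k)" for \<alpha> :: "nat ^ 'n"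
  proof -
    have "(\<Prod>i\<in>UNIV. (?\<omega> $ i) ^ (\<alpha> $ i)) = (\<Prod>i\<in>UNIV. if i = k then (- 1) ^ (\<alpha> $ i) else 1)"
      by (rule prod.cong) auto
    then show ?thesis
      by simp
  qed
  have "Poly_Mapping.lookup (tilde f) \<alpha> = Poly_Mapping.lookup (scale_vars ?\<omega> f) \<alpha>" for \<alpha>
  proof -
    consider "\<alpha> = \<beta>" | "\<alpha> \<noteq> \<beta>" "even_vec \<alpha>" | "\<alpha> \<noteq> \<beta>" "\<not> even_vec \<alpha>"
      by blast
    then show ?thesis
    proof cases
      case 1
      then show ?thesis
        using False k by (simp only: lookup_tilde lookup_scale_vars sgn) simp
    next
      case 2
      then have "even (\<alpha> $ k)"
        by (simp add: even_vec_def)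
      then show ?thesis
        using 2 by (simp only: lookup_tilde lookup_scale_vars sgn) simp
    next
      case 3
      then have "Poly_Mapping.lookup f \<alpha> = 0"
        using assms by (cases "\<alpha> \<in> A") (auto simp: AG_cone_def in_keys_iff)
      then show ?thesis
        by (simp add: lookup_tilde lookup_scale_vars)
    qed
  qed
  then show ?thesis
    using that poly_mapping_eqI by blast
qed

text \<open>
  Although \<open>tilde\<close> is not additive in general, it commutes with the sum over a SONC decomposition:
  it is linear on even coefficients, and the coefficient of \<open>p\<close> at an odd \<open>\<gamma>\<close> comes from the single
  summand with distinguished exponent \<open>\<gamma>\<close>.
\<close>

lemma SONC_tilde_decomposition:
  fixes p :: "('n::finite) rpoly"
  assumes "SONC_poly p"
  obtains T g where "finite T" "tilde p = (\<Sum>\<beta>\<in>T. g \<beta>)"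
    "\<And>\<beta>. \<beta> \<in> T \<Longrightarrow> Poly_Mapping.keys (g \<beta>) \<subseteq> T"
    "\<And>\<alpha> \<beta>. \<beta> \<in> T \<Longrightarrow> \<alpha> \<noteq> \<beta> \<Longrightarrow> 0 \<le> Poly_Mapping.lookup (g \<beta>) \<alpha>"
    "\<And>\<beta> x. \<beta> \<in> T \<Longrightarrow> 0 \<le> peval (g \<beta>) x"
proof -
  from assms obtain T where T: "finite T" and "p \<in> SONC_cone T"
    by (auto simp: SONC_poly_def)
  then obtain f where p: "p = (\<Sum>\<beta>\<in>T. f \<beta>)"
    and f: "\<And>\<beta>. \<beta> \<in> T \<Longrightarrow> f \<beta> \<in> AG_cone (T - {\<beta>}) \<beta>"
    unfolding SONC_cone_def set_sum_alt[OF T] by blast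
  have keys: "Poly_Mapping.keys (f \<beta>) \<subseteq> T" if "\<beta> \<in> T" for \<beta>
    using f[OF that] that by (auto simp: AG_cone_def)
  have odd0: "Poly_Mapping.lookup (f \<beta>) \<gamma> = 0" if "\<beta> \<in> T" "\<gamma> \<noteq> \<beta>" "\<not> even_vec \<gamma>" for \<beta> \<gamma>
    using f[OF that(1)] that keys[OF that(1)] by (cases "\<gamma> \<in> T") (auto simp: AG_cone_def in_keys_iff)
  have "tilde p = (\<Sum>\<beta>\<in>T. tilde (f \<beta>))"
  proof (rule poly_mapping_eqI)
    fix \<gamma>
    show "Poly_Mapping.lookup (tilde p) \<gamma> = Poly_Mapping.lookup (\<Sum>\<beta>\<in>T. tilde (f \<beta>)) \<gamma>"
    proof (cases "even_vec \<gamma>")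
      case True
      then show ?thesis
        by (simp add: p lookup_sum lookup_tilde)
    next
      case False
      have "(\<Sum>\<beta>\<in>T. h (Poly_Mapping.lookup (f \<beta>) \<gamma>)) =
          (\<Sum>\<beta>\<in>T. if \<beta> = \<gamma> then h (Poly_Mapping.lookup (f \<gamma>) \<gamma>) else 0)"
        if "h 0 = 0" for h :: "real \<Rightarrow> real"
        by (rule sum.cong) (use that odd0 False in auto)
      from this[of "\<lambda>c. c"] this[of "\<lambda>c. - \<bar>c\<bar>"] show ?thesis
        using False T by (simp add: p lookup_sum lookup_tilde)
    qed
  qed
  moreover have "0 \<le> Poly_Mapping.lookup (tilde (f \<beta>)) \<alpha>" if "\<beta> \<in> T" "\<alpha> \<noteq> \<beta>" for \<alpha> \<beta>
  proof -
    have "0 \<le> Poly_Mapping.lookup (f \<beta>) \<alpha>"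
    proof (cases "\<alpha> \<in> T")
      case True
      then show ?thesis
        using f[OF that(1)] that(2) by (simp add: AG_cone_def)
    next
      case False
      then have "\<alpha> \<notin> Poly_Mapping.keys (f \<beta>)"
        using keys[OF that(1)] by blast
      then show ?thesis
        by (simp add: in_keys_iff)
    qed
    then show ?thesis
      using odd0[OF that] by (simp add: lookup_tilde)
  qed
  moreover have "0 \<le> peval (tilde (f \<beta>)) x" if \<beta>: "\<beta> \<in> T" for \<beta> x
  proof -
    obtain \<omega> where "tilde (f \<beta>) = scale_vars \<omega> (f \<beta>)"
      using AG_tilde_eq_scale_vars[OF f[OF \<beta>]] .
    then show ?thesis
      using f[OF \<beta>] by (simp add: peval_scale_vars AG_cone_def)
  qed
  ultimately show ?thesis
    using that[of T "\<lambda>\<beta>. tilde (f \<beta>)"] T keys by (simp add: keys_tilde)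
qed

section \<open>Zeros in logarithmic coordinates\<close>

definition exp_vec :: "real ^ 'n \<Rightarrow> real ^ 'n" where
  "exp_vec y = (\<chi> i. exp (y $ i))"

definition real_exponent :: "nat ^ 'n \<Rightarrow> real ^ 'n" where
  "real_exponent \<alpha> = (\<chi> i. real (\<alpha> $ i))"

definition log_zeros :: "('n::finite) rpoly \<Rightarrow> (real ^ 'n) set" where
  "log_zeros q = {y. peval q (exp_vec y) = 0}"

lemma monomial_exp_vec:
  "(\<Prod>i\<in>UNIV. (exp_vec y $ i) ^ (\<alpha> $ i)) = exp (real_exponent \<alpha> \<bullet> y)"
  by (simp add: exp_vec_def real_exponent_def inner_vec_def exp_sum exp_of_nat_mult)

lemma V_pos_eq_exp_image: "V_pos q = exp_vec ` log_zeros q"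
proof -
  have "x \<in> exp_vec ` log_zeros q" if "x \<in> V_pos q" for x
  proof -
    have "x = exp_vec (\<chi> i. ln (x $ i))"
      using that by (simp add: vec_eq_iff exp_vec_def V_pos_def pos_orthant_def)
    then show ?thesis
      using that by (metis (mono_tags, lifting) V_pos_def image_eqI log_zeros_def mem_Collect_eq)
  qed
  then show ?thesis
    by (auto simp: V_pos_def log_zeros_def pos_orthant_def exp_vec_def)
qed

text \<open>
  Divide \<open>g\<close> by the monomial with exponent \<open>\<beta>\<close>. With \<open>Y \<alpha>\<close> and \<open>Z \<alpha>\<close> denoting the square roots of
  the resulting exponentials at \<open>y\<close> and \<open>z\<close>, the quotient has the values \<open>\<Sum> c \<alpha> * (Y \<alpha>)\<^sup>2\<close> and
  \<open>\<Sum> c \<alpha> * (Z \<alpha>)\<^sup>2\<close> at these points and \<open>\<Sum> c \<alpha> * (Y \<alpha> * Z \<alpha>)\<close> at their midpoint. The first two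
  vanish and the third is nonnegative, so \<open>\<Sum> c \<alpha> * (Y \<alpha> - Z \<alpha>)\<^sup>2 \<le> 0\<close>. The only possibly negative
  coefficient is \<open>c \<beta>\<close>, and \<open>Y \<beta> = Z \<beta> = 1\<close>; hence every summand is zero.
\<close>

lemma AG_log_zeros_exponents:
  fixes g :: "('n::finite) rpoly"
  assumes nonneg: "\<And>\<alpha>. \<alpha> \<noteq> \<beta> \<Longrightarrow> 0 \<le> Poly_Mapping.lookup g \<alpha>"
    and ge0: "\<And>x. 0 \<le> peval g x"
    and yz: "y \<in> log_zeros g" "z \<in> log_zeros g"
    and \<alpha>: "Poly_Mapping.lookup g \<alpha> \<noteq> 0"
  shows "real_exponent \<alpha> \<bullet> (z - y) = real_exponent \<beta> \<bullet> (z - y)"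
proof (cases "\<alpha> = \<beta>")
  case False
  define c where "c \<alpha> = Poly_Mapping.lookup g \<alpha>" for \<alpha>
  define m where "m = (1/2) *\<^sub>R (y + z)"
  define Y Z where "Y \<alpha> = exp ((real_exponent \<alpha> - real_exponent \<beta>) \<bullet> y / 2)"
    and "Z \<alpha> = exp ((real_exponent \<alpha> - real_exponent \<beta>) \<bullet> z / 2)" for \<alpha> :: "nat ^ 'n"
  have eq: "peval g (exp_vec v) = exp (real_exponent \<beta> \<bullet> v) *
      (\<Sum>\<alpha>\<in>Poly_Mapping.keys g. c \<alpha> * exp ((real_exponent \<alpha> - real_exponent \<beta>) \<bullet> v))" for v
    by (simp add: peval_def monomial_exp_vec c_def sum_distrib_left mult.left_commute
        flip: exp_add, simp add: inner_diff_left)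
  have y: "(\<Sum>\<alpha>\<in>Poly_Mapping.keys g. c \<alpha> * (Y \<alpha>)\<^sup>2) = 0"
    using yz(1) by (simp add: log_zeros_def eq Y_def flip: exp_double)
  have z: "(\<Sum>\<alpha>\<in>Poly_Mapping.keys g. c \<alpha> * (Z \<alpha>)\<^sup>2) = 0"
    using yz(2) by (simp add: log_zeros_def eq Z_def flip: exp_double)
  have m: "0 \<le> (\<Sum>\<alpha>\<in>Poly_Mapping.keys g. c \<alpha> * (Y \<alpha> * Z \<alpha>))"
    using ge0[of "exp_vec m"]
    by (simp add: eq m_def Y_def Z_def zero_le_mult_iff inner_add_right add_divide_distrib flip: exp_add)
  have "(\<Sum>\<alpha>\<in>Poly_Mapping.keys g. c \<alpha> * (Y \<alpha> - Z \<alpha>)\<^sup>2) =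
      (\<Sum>\<alpha>\<in>Poly_Mapping.keys g. c \<alpha> * (Y \<alpha>)\<^sup>2) + (\<Sum>\<alpha>\<in>Poly_Mapping.keys g. c \<alpha> * (Z \<alpha>)\<^sup>2)
        - 2 * (\<Sum>\<alpha>\<in>Poly_Mapping.keys g. c \<alpha> * (Y \<alpha> * Z \<alpha>))"
    by (simp add: sum_distrib_left power2_diff algebra_simps flip: sum.distrib sum_subtractf)
  then have le0: "(\<Sum>\<alpha>\<in>Poly_Mapping.keys g. c \<alpha> * (Y \<alpha> - Z \<alpha>)\<^sup>2) \<le> 0"
    using y z m by simp
  have summand: "0 \<le> c \<gamma> * (Y \<gamma> - Z \<gamma>)\<^sup>2" for \<gamma>
    using nonneg[of \<gamma>] by (cases "\<gamma> = \<beta>") (simp_all add: Y_def Z_def c_def)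
  then have "(\<Sum>\<alpha>\<in>Poly_Mapping.keys g. c \<alpha> * (Y \<alpha> - Z \<alpha>)\<^sup>2) = 0"
    using le0 by (intro antisym sum_nonneg)
  then have "c \<alpha> * (Y \<alpha> - Z \<alpha>)\<^sup>2 = 0"
    using \<alpha> summand by (simp add: sum_nonneg_eq_0_iff in_keys_iff)
  then have "Y \<alpha> = Z \<alpha>"
    using \<alpha> by (simp add: c_def)
  then show ?thesis
    by (simp add: Y_def Z_def inner_diff_left inner_diff_right)
qed simp

text \<open>
  All exponents that occur grow at the same rate along the line through two zeros, so on this line
  \<open>g\<close> is its value at a zero times an exponential factor.
\<close>

lemma AG_log_zeros_affine:
  fixes g :: "('n::finite) rpoly"
  assumes nonneg: "\<And>\<alpha>. \<alpha> \<noteq> \<beta> \<Longrightarrow> 0 \<le> Poly_Mapping.lookup g \<alpha>"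
    and ge0: "\<And>x. 0 \<le> peval g x"
  shows "affine (log_zeros g)"
  unfolding affine_alt
proof (intro ballI allI)
  fix y z :: "real ^ 'n" and u :: real
  assume yz: "y \<in> log_zeros g" "z \<in> log_zeros g"
  have line: "(1 - u) *\<^sub>R y + u *\<^sub>R z = u *\<^sub>R (z - y) + y"
    by (simp add: algebra_simps)
  have "real_exponent \<alpha> \<bullet> ((1 - u) *\<^sub>R y + u *\<^sub>R z) =
      u * (real_exponent \<beta> \<bullet> (z - y)) + real_exponent \<alpha> \<bullet> y" if "\<alpha> \<in> Poly_Mapping.keys g" for \<alpha>
  proof -
    have "real_exponent \<alpha> \<bullet> (z - y) = real_exponent \<beta> \<bullet> (z - y)"
      by (rule AG_log_zeros_exponents[of \<beta> g, OF nonneg ge0 yz]) (use that in \<open>simp_all add: in_keys_iff\<close>)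
    then show ?thesis
      by (simp only: line inner_add_right inner_scaleR_right)
  qed
  then have "peval g (exp_vec ((1 - u) *\<^sub>R y + u *\<^sub>R z)) =
      exp (u * (real_exponent \<beta> \<bullet> (z - y))) * peval g (exp_vec y)"
    by (simp add: peval_def monomial_exp_vec exp_add sum_distrib_left mult.left_commute cong: sum.cong)
  then show "(1 - u) *\<^sub>R y + u *\<^sub>R z \<in> log_zeros g"
    using yz(1) by (simp add: log_zeros_def)
qed

text \<open>
  Comparing the zeros \<open>0\<close> and \<open>axis i 1\<close> forces every occurring exponent to agree with \<open>\<beta>\<close> in the
  coordinate \<open>i\<close>. Thus \<open>g\<close> is a single monomial, and it has a positive zero.
\<close>

lemma AG_log_zeros_UNIV:
  fixes g :: "('n::finite) rpoly"
  assumes nonneg: "\<And>\<alpha>. \<alpha> \<noteq> \<beta> \<Longrightarrow> 0 \<le> Poly_Mapping.lookup g \<alpha>"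
    and ge0: "\<And>x. 0 \<le> peval g x"
    and all: "log_zeros g = UNIV"
  shows "g = 0"
proof -
  have "\<alpha> = \<beta>" if "Poly_Mapping.lookup g \<alpha> \<noteq> 0" for \<alpha>
  proof -
    have "real_exponent \<alpha> \<bullet> (axis i 1 - 0) = real_exponent \<beta> \<bullet> (axis i 1 - 0)" for i
      by (rule AG_log_zeros_exponents[of \<beta> g, OF nonneg ge0 _ _ that]) (simp_all add: all)
    then show ?thesis
      by (simp add: vec_eq_iff inner_axis real_exponent_def)
  qed
  then have sub: "Poly_Mapping.keys g \<subseteq> {\<beta>}"
    by (auto simp: in_keys_iff)
  have "peval g (exp_vec 0) = 0"
    using all by (auto simp: log_zeros_def)
  then have "Poly_Mapping.lookup g \<beta> = 0"
    by (simp add: peval_superset[OF _ sub] monomial_exp_vec)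
  then show ?thesis
    using sub by (metis in_keys_iff keys_eq_empty subset_singletonD insertI1)
qed

lemma SONC_tilde_nonneg_affine_zeros:
  fixes p :: "('n::finite) rpoly"
  assumes "SONC_poly p"
  shows "affine (log_zeros (tilde p))"
    and "tilde p \<noteq> 0 \<Longrightarrow> log_zeros (tilde p) \<noteq> UNIV"
    and "0 \<le> peval (tilde p) x"
proof -
  obtain T g where T: "finite T" and p: "tilde p = (\<Sum>\<beta>\<in>T. g \<beta>)"
    and keys: "\<And>\<beta>. \<beta> \<in> T \<Longrightarrow> Poly_Mapping.keys (g \<beta>) \<subseteq> T"
    and nonneg: "\<And>\<alpha> \<beta>. \<beta> \<in> T \<Longrightarrow> \<alpha> \<noteq> \<beta> \<Longrightarrow> 0 \<le> Poly_Mapping.lookup (g \<beta>) \<alpha>"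
    and ge0: "\<And>\<beta> x. \<beta> \<in> T \<Longrightarrow> 0 \<le> peval (g \<beta>) x"
    using SONC_tilde_decomposition[OF assms] by metis
  have ev: "peval (tilde p) x = (\<Sum>\<beta>\<in>T. peval (g \<beta>) x)" for x
    using peval_sum[OF T keys] by (simp add: p)
  then show "0 \<le> peval (tilde p) x"
    using ge0 by (simp add: sum_nonneg)
  have zeros: "log_zeros (tilde p) = (\<Inter>\<beta>\<in>T. log_zeros (g \<beta>))"
    using ge0 by (auto simp: log_zeros_def ev sum_nonneg_eq_0_iff[OF T])
  show "affine (log_zeros (tilde p))"
    unfolding zeros using AG_log_zeros_affine nonneg ge0 by (intro affine_Inter) blast
  show "log_zeros (tilde p) \<noteq> UNIV" if "tilde p \<noteq> 0"
  proof
    assume "log_zeros (tilde p) = UNIV"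
    then have "g \<beta> = 0" if "\<beta> \<in> T" for \<beta>
      using AG_log_zeros_UNIV[of \<beta> "g \<beta>"] nonneg ge0 that by (auto simp: zeros)
    then show False
      using \<open>tilde p \<noteq> 0\<close> by (simp add: p)
  qed
qed

section \<open>Symmetric affine subspaces\<close>

definition swap_coords :: "'n \<Rightarrow> 'n \<Rightarrow> real ^ 'n \<Rightarrow> real ^ 'n" where
  "swap_coords i j y = (\<chi> k. y $ Transposition.transpose i j k)"

lemma log_zeros_tilde_swap:
  fixes p :: "('n::finite) rpoly"
  assumes "symmetric_poly p" "y \<in> log_zeros (tilde p)"
  shows "swap_coords i j y \<in> log_zeros (tilde p)"
proof -
  let ?\<sigma> = "Transposition.transpose i j"
  have perm: "?\<sigma> permutes UNIV"
    by (simp add: permutes_swap_id)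
  have "permute_vars ?\<sigma> p = p"
    using assms(1) perm by (simp add: symmetric_poly_def)
  then have "Poly_Mapping.lookup p (\<chi> k. \<beta> $ ?\<sigma> k) = Poly_Mapping.lookup p \<beta>" for \<beta>
    by (metis lookup_permute_vars[OF perm])
  moreover have "even_vec (\<chi> k. \<beta> $ ?\<sigma> k) = even_vec \<beta>" for \<beta> :: "nat ^ 'n"
    by (simp add: even_vec_def) (metis transpose_involutory)
  ultimately have "permute_vars ?\<sigma> (tilde p) = tilde p"
    by (intro poly_mapping_eqI) (simp add: lookup_permute_vars[OF perm] lookup_tilde)
  then have "peval (tilde p) (\<chi> k. exp_vec y $ ?\<sigma> k) = peval (tilde p) (exp_vec y)"
    by (metis peval_permute_vars[OF perm])
  moreover have "(\<chi> k. exp_vec y $ ?\<sigma> k) = exp_vec (swap_coords i j y)"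
    by (simp add: exp_vec_def swap_coords_def vec_eq_iff)
  ultimately show ?thesis
    using assms(2) by (simp add: log_zeros_def)
qed

lemma sum_zero_mem_of_axis_diffs:
  fixes w :: "real ^ 'n::finite"
  assumes "subspace W" "\<And>k. axis k 1 - axis l 1 \<in> W" "(\<Sum>k\<in>UNIV. w $ k) = 0"
  shows "w \<in> W"
proof -
  have "w = (\<Sum>k\<in>UNIV. (w $ k) *\<^sub>R (axis k 1 - axis l 1))"
  proof -
    have "(\<Sum>k\<in>UNIV. (w $ k) *\<^sub>R (axis k 1 :: real ^ 'n)) = w"
      using basis_expansion[of w] by (simp add: scalar_mult_eq_scaleR)
    moreover have "(\<Sum>k\<in>UNIV. (w $ k) *\<^sub>R (axis l 1 :: real ^ 'n)) = 0"
      using assms(3) by (simp flip: scaleR_left.sum)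
    ultimately show ?thesis
      by (simp add: scaleR_diff_right sum_subtractf)
  qed
  then show ?thesis
    using assms(1,2) by (metis (no_types, lifting) subspace_sum subspace_scale)
qed

text \<open>
  If some \<open>w \<in> W\<close> has \<open>w $ i \<noteq> w $ j\<close>, then the difference of \<open>w\<close> and its swap is a nonzero multiple
  of \<open>axis i 1 - axis j 1\<close>. Swapping this vector yields all \<open>axis k 1 - axis j 1\<close>, which span the
  hyperplane of coordinate sum \<open>0\<close>; a subspace containing this hyperplane properly is everything.
  Otherwise \<open>W\<close> lies in the line of constant vectors.
\<close>

lemma swap_invariant_subspace_cases:
  fixes W :: "(real ^ 'n::finite) set"
  assumes W: "subspace W" and swap: "\<And>w i j. w \<in> W \<Longrightarrow> swap_coords i j w \<in> W"
    and "W \<noteq> UNIV"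
  shows "W = {0} \<or> W = range (\<lambda>t. \<chi> i. t) \<or> W = {w. (\<Sum>i\<in>UNIV. w $ i) = 0}"
proof (cases "\<exists>w\<in>W. \<exists>i j. w $ i \<noteq> w $ j")
  case True
  then obtain w i j where w: "w \<in> W" "w $ i \<noteq> w $ j"
    by blast
  have "w - swap_coords i j w = (w $ i - w $ j) *\<^sub>R (axis i 1 - axis j 1)"
    using w(2) by (auto simp: vec_eq_iff swap_coords_def axis_def Transposition.transpose_def)
  then have "(w $ i - w $ j) *\<^sub>R (axis i 1 - axis j 1) \<in> W"
    using subspace_diff[OF W w(1) swap[OF w(1), of i j]] by simp
  then have ij: "axis i 1 - axis j 1 \<in> W"
    using w(2) subspace_mul[OF W, of "(w $ i - w $ j) *\<^sub>R (axis i 1 - axis j 1)" "1 / (w $ i - w $ j)"]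
    by simp
  have kj: "axis k 1 - axis j 1 \<in> W" for k
  proof (cases "k = j")
    case True
    then show ?thesis
      by (simp add: subspace_0[OF W])
  next
    case False
    then have "swap_coords i k (axis i 1 - axis j 1) = axis k 1 - axis j 1"
      using w(2) by (auto simp: vec_eq_iff swap_coords_def axis_def Transposition.transpose_def)
    then show ?thesis
      using swap[OF ij, of i k] by simp
  qed
  have "(\<Sum>k\<in>UNIV. v $ k) = 0" if "v \<in> W" for v
  proof (rule ccontr)
    assume s: "(\<Sum>k\<in>UNIV. v $ k) \<noteq> 0"
    have "u \<in> W" for u
    proof -
      define c where "c = (\<Sum>k\<in>UNIV. u $ k) / (\<Sum>k\<in>UNIV. v $ k)"
      have "(\<Sum>k\<in>UNIV. (u - c *\<^sub>R v) $ k) = 0"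
        using s by (simp add: sum_subtractf flip: sum_distrib_left) (simp add: c_def)
      then have "u - c *\<^sub>R v \<in> W"
        by (rule sum_zero_mem_of_axis_diffs[OF W kj])
      from subspace_add[OF W this subspace_mul[OF W that, of c]] show ?thesis
        by simp
    qed
    then show False
      using \<open>W \<noteq> UNIV\<close> by blast
  qed
  then have "W = {w. (\<Sum>i\<in>UNIV. w $ i) = 0}"
    by (auto intro: sum_zero_mem_of_axis_diffs[OF W kj])
  then show ?thesis
    by blast
next
  case False
  have const: "\<exists>t. w = (\<chi> i. t)" if "w \<in> W" for w
    using False that by (auto simp: vec_eq_iff)
  show ?thesis
  proof (cases "W = {0}")
    case False
    then obtain w where w: "w \<in> W" "w \<noteq> 0"
      using subspace_0[OF W] by blast
    with const obtain t where "w = (\<chi> i. t)"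
      by blast
    with w have t: "(\<chi> i. t) \<in> W" "t \<noteq> 0"
      by (auto simp: vec_eq_iff)
    have "(\<chi> i. s) \<in> W" for s
      using subspace_mul[OF W t(1), of "s / t"] t(2) by (simp add: vec_eq_iff scaleR_vec_def)
    then show ?thesis
      using const by blast
  qed simp
qed

text \<open>
  The direction space \<open>W\<close> inherits the invariance. If \<open>W\<close> consists of constant vectors, then the
  base point \<open>a\<close> is constant too: its difference from a swap of itself is constant, yet has opposite
  entries at the two swapped positions.
\<close>

lemma swap_invariant_affine_cases:
  fixes Z :: "(real ^ 'n::finite) set"
  assumes Z: "affine Z" and swap: "\<And>y i j. y \<in> Z \<Longrightarrow> swap_coords i j y \<in> Z"
    and "Z \<noteq> UNIV" "Z \<noteq> {}"
  shows "(\<exists>t. Z = {\<chi> i. t}) \<or> Z = range (\<lambda>t. \<chi> i. t) \<or> (\<exists>c. Z = {y. (\<Sum>i\<in>UNIV. y $ i) = c})"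
proof -
  obtain a where a: "a \<in> Z"
    using \<open>Z \<noteq> {}\<close> by blast
  define W where "W = (\<lambda>y. y - a) ` Z"
  have Z_eq: "y \<in> Z \<longleftrightarrow> y - a \<in> W" for y
    by (auto simp: W_def)
  have W: "subspace W"
    unfolding W_def by (rule affine_diffs_subspace_subtract[OF Z a])
  have "swap_coords i j w \<in> W" if "w \<in> W" for i j w
  proof -
    have "swap_coords i j (w + a) - a \<in> W" "swap_coords i j a - a \<in> W"
      using swap[of "w + a" i j] swap[OF a, of i j] that by (simp_all add: Z_eq)
    from subspace_diff[OF W this] show ?thesis
      by (simp add: swap_coords_def vec_eq_iff plus_vec_def minus_vec_def)
  qed
  moreover have "W \<noteq> UNIV"
    using \<open>Z \<noteq> UNIV\<close> Z_eq by blast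
  moreover have "0 \<in> range (\<lambda>t :: real. \<chi> i::'n. t)"
    by (auto simp: image_iff vec_eq_iff)
  ultimately consider "W \<subseteq> range (\<lambda>t. \<chi> i. t)" "W = {0} \<or> W = range (\<lambda>t. \<chi> i. t)"
    | "W = {w. (\<Sum>i\<in>UNIV. w $ i) = 0}"
    using swap_invariant_subspace_cases[OF W] by blast
  then show ?thesis
  proof cases
    case 1
    have "a $ i = a $ j" for i j
    proof -
      have "swap_coords i j a - a \<in> W"
        using swap[OF a] by (simp add: Z_eq)
      then obtain t where "swap_coords i j a - a = (\<chi> i. t)"
        using 1(1) by blast
      then have "swap_coords i j a $ i - a $ i = t" "swap_coords i j a $ j - a $ j = t"
        by (metis vector_minus_component vec_lambda_beta)+
      then show ?thesis
        by (simp add: swap_coords_def)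
    qed
    then obtain s where s: "a = (\<chi> i. s)"
      by (metis vec_eq_iff vec_lambda_beta)
    from 1(2) show ?thesis
    proof
      assume "W = {0}"
      then have "Z = {\<chi> i. s}"
        by (auto simp: Z_eq s)
      then show ?thesis
        by blast
    next
      assume "W = range (\<lambda>t. \<chi> i. t)"
      moreover have "y - a \<in> range (\<lambda>t. \<chi> i. t) \<longleftrightarrow> y \<in> range (\<lambda>t. \<chi> i. t)" for y
      proof -
        have "(\<exists>t. \<forall>i. y $ i = t + s) \<longleftrightarrow> (\<exists>t. \<forall>i. y $ i = t)"
          by (metis diff_add_cancel)
        then show ?thesis
          by (simp add: s image_iff vec_eq_iff diff_eq_eq)
      qed
      ultimately have "Z = range (\<lambda>t. \<chi> i. t)"
        using Z_eq by blast
      then show ?thesis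
        by blast
    qed
  next
    case 2
    then have "Z = {y. (\<Sum>i\<in>UNIV. y $ i) = (\<Sum>i\<in>UNIV. a $ i)}"
      by (auto simp: Z_eq sum_subtractf)
    then show ?thesis
      by blast
  qed
qed

section \<open>Positive zeros of symmetric SONC polynomials\<close>

theorem corollary3p3:
  fixes p :: "('n::finite) rpoly" and \<omega> :: "real ^ 'n"
  assumes "\<not> constant_poly p"
    and "SONC_poly p"
    and "symmetric_poly p"
    and "\<forall>i. \<omega> $ i \<in> {1, -1}"
  shows "(scale_vars \<omega> p \<noteq> tilde p \<longrightarrow> V_pos (scale_vars \<omega> p) = {}) \<and>
    (scale_vars \<omega> p = tilde p \<longrightarrow>
      V_pos (scale_vars \<omega> p) = V_pos (tilde p) \<and>
      (V_pos (scale_vars \<omega> p) \<noteq> {} \<longrightarrow>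
        (\<exists>x \<in> pos_diagonal. V_pos (scale_vars \<omega> p) = {x}) \<or>
        V_pos (scale_vars \<omega> p) = pos_diagonal \<or>
        (\<exists>\<tau>>0. V_pos (scale_vars \<omega> p) = {x. (\<Prod>i\<in>UNIV. x $ i) = \<tau>} \<inter> pos_orthant)))"
proof -
  have part1: "V_pos (scale_vars \<omega> p) = {}" if "scale_vars \<omega> p \<noteq> tilde p"
    using peval_tilde_less_scale_vars[OF assms(4) that] SONC_tilde_nonneg_affine_zeros(3)[OF assms(2)]
    by (auto simp: V_pos_def) (metis less_le_not_le)
  have "p \<noteq> 0"
    using assms(1) by (metis constant_poly_def single_zero)
  then have "tilde p \<noteq> 0"
    by (metis keys_tilde keys_eq_empty)
  have "(\<exists>x \<in> pos_diagonal. V_pos (tilde p) = {x}) \<or> V_pos (tilde p) = pos_diagonal \<or>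
      (\<exists>\<tau>>0. V_pos (tilde p) = {x. (\<Prod>i\<in>UNIV. x $ i) = \<tau>} \<inter> pos_orthant)"
    if "V_pos (tilde p) \<noteq> {}"
  proof -
    have "log_zeros (tilde p) \<noteq> {}"
      using that by (simp add: V_pos_eq_exp_image)
    then consider t where "log_zeros (tilde p) = {\<chi> i. t}"
      | "log_zeros (tilde p) = range (\<lambda>t. \<chi> i. t)"
      | c where "log_zeros (tilde p) = {y. (\<Sum>i\<in>UNIV. y $ i) = c}"
      using swap_invariant_affine_cases[OF SONC_tilde_nonneg_affine_zeros(1)[OF assms(2)]
          log_zeros_tilde_swap[OF assms(3)] SONC_tilde_nonneg_affine_zeros(2)[OF assms(2) \<open>tilde p \<noteq> 0\<close>]]
      by blast
    then show ?thesis
    proof cases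
      case (1 t)
      then have "V_pos (tilde p) = {\<chi> i. exp t}"
        by (simp add: V_pos_eq_exp_image exp_vec_def)
      moreover have "(\<chi> i. exp t) \<in> (pos_diagonal :: (real ^ 'n) set)"
        by (auto simp: pos_diagonal_def)
      ultimately show ?thesis
        by blast
    next
      case 2
      have "(\<chi> i. s) \<in> exp_vec ` range (\<lambda>t. \<chi> i. t)" if "s > 0" for s
        using that by (auto simp: exp_vec_def image_iff intro!: exI[of _ "ln s"])
      then have "V_pos (tilde p) = pos_diagonal"
        unfolding V_pos_eq_exp_image 2 by (auto simp: pos_diagonal_def exp_vec_def)
      then show ?thesis
        by blast
    next
      case (3 c)
      have "x \<in> exp_vec ` {y. (\<Sum>i\<in>UNIV. y $ i) = c}"
        if "x \<in> pos_orthant" "(\<Prod>i\<in>UNIV. x $ i) = exp c" for x :: "real ^ 'n"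
      proof
        show x: "x = exp_vec (\<chi> i. ln (x $ i))"
          using that(1) by (simp add: vec_eq_iff exp_vec_def pos_orthant_def)
        have "exp (\<Sum>i\<in>UNIV. ln (x $ i)) = exp c"
          using that by (simp add: exp_sum pos_orthant_def)
        then show "(\<chi> i. ln (x $ i)) \<in> {y. (\<Sum>i\<in>UNIV. y $ i) = c}"
          by simp
      qed
      then have "V_pos (tilde p) = {x. (\<Prod>i\<in>UNIV. x $ i) = exp c} \<inter> pos_orthant"
        unfolding V_pos_eq_exp_image 3
        by (auto simp: exp_vec_def pos_orthant_def exp_sum)
      then show ?thesis
        by (metis exp_gt_zero)
    qed
  qed
  then show ?thesis
    using part1 by simp
qed

end
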